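(* Let $m\ge 1$ and $n\ge 2$ be integers and let $D=\{x_1,\ldots,x_n\}$ be an $n$-run order-of-addition (OofA) design with $m$ components. Let $X$ be the model matrix of $D$ under the pairwise ordering model and $M=X^\top X$. Then $$\operatorname{tr}(M^2)=4n(n-1)\,k_{m_2}(D)-\{2m(m-1)+4\}\,n(n-1)\,k_{\mathrm{ave}}(D)+\frac{n^2(m^2-m+2)^2}{4}.$$
   Context: Let $\mathcal{Z}_m=\{0,1,\ldots,m-1\}$ and let $\mathcal{S}_m$ be the set of all permutations (orderings) $x=(x^{(1)},\ldots,x^{(m)})$ of $\mathcal{Z}_m$. An $n$-run OofA design with $m$ components is a list (repetitions allowed) $D=\{x_1,\ldots,x_n\}$ of $n$ elements of $\mathcal{S}_m$, called runs. For $x\in\mathcal{S}_m$ and a component $c\in\mathcal{Z}_m$, $\pi_x(c)$ denotes the position of $c$ in $x$, i.e. $\pi_x(c)=r$ iff the $r$-th entry of $x$ is $c$. Kendall tau distance: $k(x,y)=\#\{(a,b):0\le a<b\le m-1,\ (\pi_x(a)-\pi_x(b))(\pi_y(a)-\pi_y(b))<0\}$. Distance criteria: $k_{\mathrm{ave}}(D)=\binom{n}{2}^{-1}\sum_{1\le i<j\le n}k(x_i,x_j)$ and $k_{m_2}(D)=\binom{n}{2}^{-1}\sum_{1\le i<j\le n}k(x_i,x_j)^2$. Pairwise ordering (PWO) coding: for $0\le a<b\le m-1$, $z_{ab}(x)=+1$ if $\pi_x(a)<\pi_x(b)$ and $z_{ab}(x)=-1$ if $\pi_x(a)>\pi_x(b)$;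 $z(x)=(z_{ab}(x):0\le a<b\le m-1)^\top\in\{\pm1\}^{q}$ with $q=\binom m2$. The PWO model matrix $X$ of $D$ is the $n\times(1+q)$ matrix whose $i$-th row is $(1,z(x_i)^\top)$. *)

theory Defs
  imports
    "HOL-Combinatorics.Multiset_Permutations"
    "Jordan_Normal_Form.Matrix"
begin

text \<open>Components are \<open>0, \<dots>, m - 1\<close>. A run is an ordering of them, given as a list; an
  \<open>n\<close>-run design is a list of \<open>n\<close> runs. List indices start at 0, so
  \<open>x\<^sub>i\<close> is \<open>D ! (i - 1)\<close>.\<close>

definition runs :: "nat \<Rightarrow> nat list set" where
  "runs m = permutations_of_set {0..<m}"

definition oofa_design :: "nat \<Rightarrow> nat \<Rightarrow> nat list list \<Rightarrow> bool" where
  "oofa_design m n D \<longleftrightarrow> length D = n \<and> set D \<subseteq> runs m"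

text \<open>Positions are counted from 1 and are integers, so that their differences do not truncate.\<close>

definition position :: "nat list \<Rightarrow> nat \<Rightarrow> int" where
  "position x c = int (THE r. 1 \<le> r \<and> r \<le> length x \<and> x ! (r - 1) = c)"

definition kendall_tau :: "nat \<Rightarrow> nat list \<Rightarrow> nat list \<Rightarrow> nat" where
  "kendall_tau m x y = card {(a, b). a < b \<and> b < m \<and>
     (position x a - position x b) * (position y a - position y b) < 0}"

definition k_ave :: "nat \<Rightarrow> nat list list \<Rightarrow> real" where
  "k_ave m D = (\<Sum>(i, j) \<in> {(i, j). i < j \<and> j < length D}.
     real (kendall_tau m (D ! i) (D ! j))) / real (length D choose 2)"

definition k_m2 :: "nat \<Rightarrow> nat list list \<Rightarrow> real" where
  "k_m2 m D = (\<Sum>(i, j) \<in> {(i, j). i < j \<and> j < length D}.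
     (real (kendall_tau m (D ! i) (D ! j)))\<^sup>2) / real (length D choose 2)"

text \<open>The coordinates of the pairwise ordering (PWO) coding are arranged lexicographically in
  \<open>(a, b)\<close>. In a run, distinct components have distinct positions, so the last case of
  \<open>pwo\<close> means \<open>position x a > position x b\<close>.\<close>

definition component_pairs :: "nat \<Rightarrow> (nat \<times> nat) list" where
  "component_pairs m = [(a, b). a \<leftarrow> [0..<m], b \<leftarrow> [Suc a..<m]]"

definition pwo :: "nat list \<Rightarrow> nat \<Rightarrow> nat \<Rightarrow> real" where
  "pwo x a b = (if position x a < position x b then 1 else - 1)"

definition pwo_coding :: "nat \<Rightarrow> nat list \<Rightarrow> real list" where
  "pwo_coding m x = map (\<lambda>(a, b). pwo x a b) (component_pairs m)"

definition pwo_model_matrix :: "nat \<Rightarrow> nat list list \<Rightarrow> real mat" where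
  "pwo_model_matrix m D = mat_of_rows_list (1 + (m choose 2)) (map (\<lambda>x. 1 # pwo_coding m x) D)"

definition mat_trace :: "'a::comm_monoid_add mat \<Rightarrow> 'a" where
  "mat_trace A = (\<Sum>i < dim_row A. A $$ (i, i))"

lemma set_component_pairs: "set (component_pairs m) = {(a, b). a < b \<and> b < m}"
  by (force simp: component_pairs_def)

lemma distinct_component_pairs: "distinct (component_pairs m)"
proof -
  have "distinct [(a, b). a \<leftarrow> xs, b \<leftarrow> [Suc a..<m]]" if "distinct xs" for xs
    using that by (induction xs) (auto simp: distinct_map inj_on_def)
  then show ?thesis by (simp add: component_pairs_def)
qed

lemma length_pwo_coding: "length (pwo_coding m x) = m choose 2"
proof -
  have "length (component_pairs m) = (\<Sum>a<m. m - Suc a)"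
    by (simp add: component_pairs_def length_concat comp_def interv_sum_list_conv_sum_set_nat
        atLeast0LessThan)
  also have "\<dots> = (\<Sum>a<m. a)"
    by (rule sum.nat_diff_reindex)
  also have "\<dots> = m choose 2"
    by (induction m) (auto simp: numeral_2_eq_2)
  finally show ?thesis by (simp add: pwo_coding_def)
qed

lemma position_eq_iff:
  assumes "x \<in> runs m" "c < m" "1 \<le> r" "r \<le> m"
  shows "position x c = int r \<longleftrightarrow> x ! (r - 1) = c"
proof -
  have d: "distinct x" and s: "set x = {0..<m}" and l: "length x = m"
    using assms(1) length_finite_permutations_of_set[of x "{0..<m}"]
    by (auto simp: runs_def permutations_of_set_def distinct_card[symmetric])
  obtain i where i: "i < m" "x ! i = c"
    using assms(2) s l by (metis atLeastLessThan_iff in_set_conv_nth zero_le)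
  have "(THE r. 1 \<le> r \<and> r \<le> length x \<and> x ! (r - 1) = c) = Suc i"
  proof (rule the_equality)
    fix r assume "1 \<le> r \<and> r \<le> length x \<and> x ! (r - 1) = c"
    then show "r = Suc i"
      using d i l nth_eq_iff_index_eq[of x "r - 1" i] by auto
  qed (use i l in auto)
  then have p: "position x c = int (Suc i)"
    by (simp add: position_def)
  show ?thesis
    unfolding p using assms d i l nth_eq_iff_index_eq[of x "r - 1" i] by auto
qed

end

(* Since tr ((X\<^sup>T X)\<^sup>2) = tr ((X X\<^sup>T)\<^sup>2), the trace is the sum of the squared entries of the Gram matrix of
   the rows of X. The PWO codings of two runs disagree exactly at the discordant pairs, so this
   matrix has the entries Q - 2 k(x\<^sub>i, x\<^sub>j) with Q = 1 + q = (m\<^sup>2 - m + 2) / 2. Expanding the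
   squares gives the claim, because k is symmetric and vanishes on the diagonal. *)
theory Submission
  imports Defs
begin

text \<open>Both sides are the sum of
  \<open>X $$ (i, s) * X $$ (j, s) * X $$ (i, t) * X $$ (j, t)\<close> over all rows
  \<open>i\<close>, \<open>j\<close> and columns \<open>s\<close>, \<open>t\<close>. With the row
  indices outermost, the sum over \<open>s\<close> and \<open>t\<close> factors into a
  square.\<close>

lemma mat_trace_gram_squared:
  fixes X :: "'a::comm_semiring_1 mat"
  assumes X: "X \<in> carrier_mat n p"
  shows "mat_trace ((X\<^sup>T * X) ^\<^sub>m 2) = (\<Sum>i<n. \<Sum>j<n. (row X i \<bullet> row X j)\<^sup>2)"
proof -
  define G where "G = X\<^sup>T * X"
  have G: "G \<in> carrier_mat p p"
    using X by (auto simp: G_def)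
  have entry: "G $$ (s, t) = (\<Sum>i<n. X $$ (i, s) * X $$ (i, t))" if "s < p" "t < p" for s t
    using X that by (auto simp: G_def scalar_prod_def atLeast0LessThan intro!: sum.cong)
  have "mat_trace (G ^\<^sub>m 2) = mat_trace (G * G)"
    using G by (simp add: numeral_2_eq_2)
  also have "\<dots> = (\<Sum>s<p. \<Sum>t<p. G $$ (s, t) * G $$ (t, s))"
    using G by (auto simp: mat_trace_def scalar_prod_def atLeast0LessThan intro!: sum.cong)
  also have "\<dots> = (\<Sum>s<p. \<Sum>t<p. \<Sum>i<n. \<Sum>j<n.
      (X $$ (i, s) * X $$ (j, s)) * (X $$ (i, t) * X $$ (j, t)))"
    by (intro sum.cong refl) (simp add: entry sum_product ac_simps)
  also have "\<dots> = (\<Sum>i<n. \<Sum>j<n. \<Sum>s<p. \<Sum>t<p.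
      (X $$ (i, s) * X $$ (j, s)) * (X $$ (i, t) * X $$ (j, t)))"
    \<comment> \<open>Fixing both index sets orients the exchange: a row sum only ever moves outside
      a column sum.\<close>
    unfolding sum.swap[of _ "{..<n}" "{..<p}"] ..
  also have "\<dots> = (\<Sum>i<n. \<Sum>j<n. (\<Sum>s<p. X $$ (i, s) * X $$ (j, s))\<^sup>2)"
    by (simp add: power2_eq_square sum_product)
  also have "\<dots> = (\<Sum>i<n. \<Sum>j<n. (row X i \<bullet> row X j)\<^sup>2)"
    using X by (auto simp: scalar_prod_def atLeast0LessThan intro!: sum.cong)
  finally show ?thesis
    by (simp add: G_def)
qed

lemma position_inj:
  assumes "x \<in> runs m" "a < m" "b < m" "position x a = position x b"
  shows "a = b"
proof -
  have "a \<in> set x" and len: "length x = m"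
    using assms(1,2) length_finite_permutations_of_set[of x "{0..<m}"]
    by (auto simp: runs_def permutations_of_set_def)
  then obtain i where "i < m" "x ! i = a"
    by (auto simp: in_set_conv_nth)
  \<comment> \<open>List index \<open>i\<close> is position \<open>Suc i\<close>, and the entry
    there is unique.\<close>
  then show ?thesis
    using assms position_eq_iff[OF assms(1,2), of "Suc i"] position_eq_iff[OF assms(1,3), of "Suc i"]
    by simp
qed

text \<open>Injectivity of positions excludes ties, for which the \<open>else\<close> branch of
  \<open>pwo\<close> would not match the sign of the difference.\<close>

lemma pwo_mult:
  assumes "x \<in> runs m" "y \<in> runs m" "a < m" "b < m" "a \<noteq> b"
  shows "pwo x a b * pwo y a b =
    1 - 2 * of_bool ((position x a - position x b) * (position y a - position y b) < 0)"
proof -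
  have "position x a \<noteq> position x b" "position y a \<noteq> position y b"
    using assms position_inj by blast+
  then show ?thesis
    by (auto simp: pwo_def mult_less_0_iff)
qed

lemma finite_less_pairs: "finite {(i, j). i < j \<and> j < (n::nat)}"
  by (rule finite_subset[of _ "{..<n} \<times> {..<n}"]) auto

text \<open>\<open>component_pairs\<close> lists these pairs without repetition and is as long as
  the coding of any list, so \<open>undefined\<close> serves as the run.\<close>

lemma card_less_pairs: "card {(a, b). a < b \<and> b < m} = m choose 2"
  using distinct_card[OF distinct_component_pairs[of m]] length_pwo_coding[of m undefined]
  by (simp add: set_component_pairs pwo_coding_def)

text \<open>Concordant pairs contribute 1 and discordant ones -1, so each discordant pair lowers the
  full count by 2.\<close>

lemma sum_pwo_mult:
  assumes "x \<in> runs m" "y \<in> runs m"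
  shows "(\<Sum>(a, b) \<in> {(a, b). a < b \<and> b < m}. pwo x a b * pwo y a b) =
    real (m choose 2) - 2 * real (kendall_tau m x y)"
proof -
  let ?P = "{(a, b). a < b \<and> b < m}"
  let ?R = "\<lambda>(a, b). (position x a - position x b) * (position y a - position y b) < 0"
  have "(\<Sum>(a, b) \<in> ?P. pwo x a b * pwo y a b) = (\<Sum>p \<in> ?P. 1 - 2 * of_bool (?R p))"
    using assms by (intro sum.cong) (auto simp: pwo_mult)
  also have "\<dots> = real (card ?P) - 2 * real (card (?P \<inter> Collect ?R))"
    by (simp add: sum_subtractf sum_distrib_left[symmetric] finite_less_pairs Int_def)
  also have "?P \<inter> Collect ?R = {(a, b). a < b \<and> b < m \<and> ?R (a, b)}"
    by auto
  finally show ?thesis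
    by (simp add: card_less_pairs kendall_tau_def)
qed

lemma row_pwo_model_matrix:
  assumes "i < length D"
  shows "row (pwo_model_matrix m D) i = vec_of_list (1 # pwo_coding m (D ! i))"
  \<comment> \<open>\<open>vec_of_list_Cons\<close> is withheld so that
    \<open>vec_of_list_index\<close> reads entries from the whole list.\<close>
  using assms by (intro eq_vecI)
    (auto simp: pwo_model_matrix_def mat_of_rows_list_def length_pwo_coding vec_of_list_index
      simp del: vec_of_list_Cons)

lemma scalar_prod_vec_of_list_map:
  "vec_of_list (map f xs) \<bullet> vec_of_list (map g xs) = (\<Sum>x\<leftarrow>xs. f x * g x)"
  by (simp add: scalar_prod_def vec_of_list_index sum_list_sum_nth)

lemma scalar_prod_rows_pwo_model_matrix:
  assumes "set D \<subseteq> runs m" "i < length D" "j < length D"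
  shows "row (pwo_model_matrix m D) i \<bullet> row (pwo_model_matrix m D) j =
    1 + real (m choose 2) - 2 * real (kendall_tau m (D ! i) (D ! j))"
proof -
  let ?x = "D ! i" and ?y = "D ! j"
  \<comment> \<open>The summand 1 comes from the intercept column.\<close>
  have "row (pwo_model_matrix m D) i \<bullet> row (pwo_model_matrix m D) j =
      1 + vec_of_list (pwo_coding m ?x) \<bullet> vec_of_list (pwo_coding m ?y)"
    using assms by (simp add: row_pwo_model_matrix scalar_prod_vCons)
  also have "\<dots> = 1 + (\<Sum>(a, b) \<in> {(a, b). a < b \<and> b < m}. pwo ?x a b * pwo ?y a b)"
    by (simp del: vec_of_list_map add: pwo_coding_def scalar_prod_vec_of_list_map sum_list_distinct_conv_sum_set
        distinct_component_pairs set_component_pairs split_def)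
  also have "\<dots> = 1 + real (m choose 2) - 2 * real (kendall_tau m ?x ?y)"
    using assms by (subst sum_pwo_mult) (auto dest: nth_mem)
  finally show ?thesis .
qed

lemma kendall_tau_commute: "kendall_tau m x y = kendall_tau m y x"
  by (simp add: kendall_tau_def mult.commute)

text \<open>For equal runs the product of differences is a square, hence never negative.\<close>

lemma kendall_tau_self: "kendall_tau m x x = 0"
  by (auto simp: kendall_tau_def mult_less_0_iff)

text \<open>This passes from ordered pairs of runs, as in the trace, to the pairs
  \<open>i < j\<close> of the distance criteria. Each induction step adds a row and a column with
  equal sums and a zero corner.\<close>

lemma sum_symmetric_square:
  fixes f :: "nat \<Rightarrow> nat \<Rightarrow> 'a::comm_semiring_1"
  assumes sym: "\<And>i j. f i j = f j i" and diag: "\<And>i. f i i = 0"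
  shows "(\<Sum>i<n. \<Sum>j<n. f i j) = 2 * (\<Sum>(i, j) \<in> {(i, j). i < j \<and> j < n}. f i j)"
proof (induction n)
  case (Suc n)
  have split: "{(i, j). i < j \<and> j < Suc n} =
      {(i, j). i < j \<and> j < n} \<union> (\<lambda>i. (i, n)) ` {..<n}"
    by (auto simp: less_Suc_eq)
  have "(\<Sum>(i, j) \<in> {(i, j). i < j \<and> j < Suc n}. f i j) =
      (\<Sum>(i, j) \<in> {(i, j). i < j \<and> j < n}. f i j) + (\<Sum>i<n. f i n)"
    unfolding split
    by (subst sum.union_disjoint) (auto simp: finite_less_pairs sum.reindex inj_on_def)
  then show ?case
    using Suc.IH by (simp add: sum.distrib diag sym[of n] algebra_simps mult_2)
qed simp

lemma real_choose_two: "real (n choose 2) = real n * (real n - 1) / 2"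
  by (induction n) (auto simp: numeral_2_eq_2 field_simps)

theorem theorem1:
  fixes m n :: nat and D :: "nat list list" and X M :: "real mat"
  assumes "m \<ge> 1" and "n \<ge> 2"
    and "oofa_design m n D"
    and "X = pwo_model_matrix m D"
    and "M = X\<^sup>T * X"
  shows "mat_trace (M ^\<^sub>m 2) =
      4 * real n * (real n - 1) * k_m2 m D
      - (2 * real m * (real m - 1) + 4) * real n * (real n - 1) * k_ave m D
      + (real n)\<^sup>2 * ((real m)\<^sup>2 - real m + 2)\<^sup>2 / 4"
proof -
  have len: "length D = n" and D: "set D \<subseteq> runs m"
    using assms(3) by (auto simp: oofa_design_def)
  let ?k = "\<lambda>i j. real (kendall_tau m (D ! i) (D ! j))"
  define Q where "Q = 1 + real (m choose 2)"
  have Q: "Q = ((real m)\<^sup>2 - real m + 2) / 2"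
    by (simp add: Q_def real_choose_two power2_eq_square field_simps)
  \<comment> \<open>The factor 2 matches the doubling in \<open>sum_symmetric_square\<close>; the
    nonzero denominator lets the averages be multiplied out.\<close>
  have pairs: "2 * real (n choose 2) = real n * (real n - 1)" "real (n choose 2) \<noteq> 0"
    using \<open>n \<ge> 2\<close> by (simp_all add: real_choose_two)
  have ave: "(\<Sum>i<n. \<Sum>j<n. ?k i j) = real n * (real n - 1) * k_ave m D"
    using pairs unfolding pairs(1)[symmetric]
    by (subst sum_symmetric_square) (auto simp: k_ave_def len kendall_tau_self intro: kendall_tau_commute)
  have m2: "(\<Sum>i<n. \<Sum>j<n. (?k i j)\<^sup>2) = real n * (real n - 1) * k_m2 m D"
    using pairs unfolding pairs(1)[symmetric]
    by (subst sum_symmetric_square) (auto simp: k_m2_def len kendall_tau_self kendall_tau_commute)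
  have "X \<in> carrier_mat n (1 + (m choose 2))"
    by (simp add: assms(4) pwo_model_matrix_def mat_of_rows_list_def len)
  then have "mat_trace (M ^\<^sub>m 2) = (\<Sum>i<n. \<Sum>j<n. (row X i \<bullet> row X j)\<^sup>2)"
    by (simp add: assms(5) mat_trace_gram_squared)
  also have "\<dots> = (\<Sum>i<n. \<Sum>j<n. (Q - 2 * ?k i j)\<^sup>2)"
    by (intro sum.cong refl)
      (simp add: assms(4) scalar_prod_rows_pwo_model_matrix[OF D] Q_def len)
  also have "\<dots> = (\<Sum>i<n. \<Sum>j<n. 4 * (?k i j)\<^sup>2 - 4 * Q * ?k i j + Q\<^sup>2)"
    by (simp add: power2_eq_square algebra_simps)
  also have "\<dots> = 4 * (\<Sum>i<n. \<Sum>j<n. (?k i j)\<^sup>2) - 4 * Q * (\<Sum>i<n. \<Sum>j<n. ?k i j)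
      + (real n)\<^sup>2 * Q\<^sup>2"
    by (simp add: sum.distrib sum_subtractf sum_distrib_left power2_eq_square)
  \<comment> \<open>Here \<open>4 * Q\<close> equals \<open>2 * real m * (real m - 1) + 4\<close>,
    and the 4 in the last denominator is the squared 2 from \<open>Q\<close>.\<close>
  also have "\<dots> = 4 * real n * (real n - 1) * k_m2 m D
      - (2 * real m * (real m - 1) + 4) * real n * (real n - 1) * k_ave m D
      + (real n)\<^sup>2 * ((real m)\<^sup>2 - real m + 2)\<^sup>2 / 4"
    unfolding ave m2 Q by (simp add: power2_eq_square field_simps)
  finally show ?thesis .
qed

end
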